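(* Let $G=(V,E)$ be a finite simple connected graph with an edge $e=uv$. Then $\beth^{1}(G/e)\le \beth^{1}(G)$.
   Context: All graphs are finite and simple. For an edge $e=uv$, $G/e$ is the simple graph obtained by contracting $e$: the vertices $u,v$ are replaced by a single vertex $v_e$ adjacent to exactly those other vertices that are adjacent to $u$ or $v$ in $G$ (no loops or multiple edges are created). The first graph characteristic is $\beth^{1}(G)=|E(G)|-|V(G)|$. *)

theory Defs
  imports Main
begin

record 'a ugraph =
  verts :: "'a set"
  edges :: "'a set set"

definition finite_simple_graph :: "'a ugraph \<Rightarrow> bool" where
  "finite_simple_graph G \<longleftrightarrow>
     finite (verts G) \<and> (\<forall>e\<in>edges G. e \<subseteq> verts G \<and> card e = 2)"

definition adj :: "'a ugraph \<Rightarrow> ('a \<times> 'a) set" where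
  "adj G = {(x, y). {x, y} \<in> edges G}"

definition connected_graph :: "'a ugraph \<Rightarrow> bool" where
  "connected_graph G \<longleftrightarrow>
     verts G \<noteq> {} \<and> (\<forall>x\<in>verts G. \<forall>y\<in>verts G. (x, y) \<in> (adj G)\<^sup>*)"

text \<open>
  Contraction \<open>G/e\<close>. The vertex type is extended by one point so that the new vertex
  \<open>v\<^sub>e\<close>, represented by \<open>None\<close>, is distinct from every surviving vertex \<open>w\<close>,
  represented by \<open>Some w\<close>.
\<close>

definition contract :: "'a ugraph \<Rightarrow> 'a set \<Rightarrow> 'a option ugraph" where
  "contract G e =
     \<lparr> verts = insert None (Some ` (verts G - e)),
       edges = {{Some x, Some y} | x y.
                  x \<in> verts G - e \<and> y \<in> verts G - e \<and> {x, y} \<in> edges G}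
             \<union> {{None, Some w} | w. w \<in> verts G - e \<and> (\<exists>z\<in>e. {z, w} \<in> edges G)} \<rparr>"

definition first_char :: "'a ugraph \<Rightarrow> int" where
  "first_char G = int (card (edges G)) - int (card (verts G))"

lemma finite_simple_graph_contract:
  assumes "finite_simple_graph G"
  shows "finite_simple_graph (contract G e)"
proof -
  have "x \<noteq> y" if "{x, y} \<in> edges G" for x y
    using assms that by (fastforce simp: finite_simple_graph_def)
  then show ?thesis
    using assms by (auto simp: finite_simple_graph_def contract_def card_insert_if)
qed

end

theory Submission
  imports Defs
begin

text \<open>
  Every edge of \<open>G/e\<close> is the image of an edge of \<open>G\<close> other than \<open>e\<close> under the quotient map on
  vertices, so contraction loses at least one edge, while it loses exactly one vertex.
\<close>

lemma finite_edges:
  assumes "finite_simple_graph G"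
  shows "finite (edges G)"
proof (rule finite_subset)
  show "edges G \<subseteq> Pow (verts G)" and "finite (Pow (verts G))"
    using assms by (auto simp: finite_simple_graph_def)
qed

text \<open>The map \<open>?q\<close> collapses \<open>e\<close> to \<open>None\<close>. Each edge
  of the contraction has an end \<open>Some w\<close> with \<open>w\<close> outside
  \<open>e\<close>, so the edge of \<open>G\<close> it comes from cannot be \<open>e\<close>
  itself.\<close>

lemma edges_contract_subset:
  "edges (contract G e) \<subseteq>
    (`) (\<lambda>x. if x \<in> e then None else Some x) ` (edges G - {e})"
  (is "_ \<subseteq> (`) ?q ` _")
proof
  fix d
  assume "d \<in> edges (contract G e)"
  then consider
    (old) x y where "d = {Some x, Some y}" "x \<notin> e" "y \<notin> e" "{x, y} \<in> edges G"
    | (new) z w where "d = {None, Some w}" "w \<notin> e" "z \<in> e" "{z, w} \<in> edges G"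
    by (auto simp: contract_def)
  then show "d \<in> (`) ?q ` (edges G - {e})"
  proof cases
    case old
    then have "d = ?q ` {x, y}" and "{x, y} \<in> edges G - {e}"
      by auto
    then show ?thesis
      by blast
  next
    case new
    then have "d = ?q ` {z, w}" and "{z, w} \<in> edges G - {e}"
      by auto
    then show ?thesis
      by blast
  qed
qed

text \<open>The loss may exceed one: if \<open>w\<close> is adjacent to both ends of
  \<open>e\<close>, its two edges to them merge into \<open>{None, Some w}\<close>.\<close>

lemma card_edges_contract_less:
  assumes "finite_simple_graph G" "e \<in> edges G"
  shows "card (edges (contract G e)) < card (edges G)"
proof -
  have "card (edges (contract G e)) \<le> card (edges G - {e})"
    using finite_edges[OF assms(1)] by (intro surj_card_le[OF _ edges_contract_subset]) simp
  also have "\<dots> < card (edges G)"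
    using finite_edges[OF assms(1)] assms(2) by (rule card_Diff1_less)
  finally show ?thesis .
qed

lemma card_verts_contract:
  assumes "finite_simple_graph G" "e \<in> edges G"
  shows "card (verts (contract G e)) + 1 = card (verts G)"
proof -
  have fin: "finite (verts G)" and e: "e \<subseteq> verts G" "card e = 2"
    using assms by (auto simp: finite_simple_graph_def)
  have "card (verts (contract G e)) = Suc (card (verts G - e))"
    using fin by (simp add: contract_def card_image)
  moreover have "card (verts G - e) = card (verts G) - 2"
    using fin e by (simp add: card_Diff_subset finite_subset)
  \<comment> \<open>This bound keeps the natural-number subtraction of 2 from truncating; the new
    vertex \<open>None\<close> then restores one.\<close>
  moreover have "2 \<le> card (verts G)"
    using card_mono[OF fin e(1)] e(2) by simp
  ultimately show ?thesis
    by simp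
qed

theorem theorem2p1p1:
  fixes G :: "'a ugraph" and u v :: 'a
  assumes "finite_simple_graph G"
    and "connected_graph G"
    and "{u, v} \<in> edges G"
  shows "first_char (contract G {u, v}) \<le> first_char G"
  \<comment> \<open>Strictness in the edge count is worth at least 1, which offsets the one vertex
    lost.\<close>
  using card_edges_contract_less[OF assms(1,3)] card_verts_contract[OF assms(1,3)]
  by (simp add: first_char_def)

end
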